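(* Let $A\in\mathbb{R}^{3\times 3}$ be such that $\lambda_1(A)\in\mathbb{R}$, $\lambda_1(A)\ne\Re(\lambda_2(A))$ and $\Im(\lambda_2(A))\neq 0$. Then there exist $B,\,C^{\mathsf T},\,\Delta C^{\mathsf T}\in\mathbb{R}^3$ such that: 1. $Ce^{At}B\ge 0$ for all $t\ge 0$, but the only proper convex $(A,B)$-invariant cone $\mathcal{K}\subset\{x\in\mathbb{R}^3: Cx\ge 0\}$ is $\mathcal{K}=\mathcal{K}_r(A,B)$, which is neither a polyhedral nor a second-order cone. 2. $(C+\Delta C)e^{At}B>0$ for all $t\ge 0$, but no proper convex $(A,B)$-invariant cone $\mathcal{K}\subset\{x\in\mathbb{R}^3:(C+\Delta C)x\ge 0\}$ is a second-order cone.
   Context: The eigenvalues $\lambda_1(A),\lambda_2(A),\lambda_3(A)$ are ordered by decreasing real part and, for equal real part, by increasing imaginary part. A convex cone is proper if it is closed, has nonempty interior and is pointed ($\mathcal{K}\cap-\mathcal{K}=\{0\}$). For $B\in\mathbb{R}^3$, a set $\mathcal{K}$ is $(A,B)$-invariant if $B\in\mathcal{K}$ and $e^{At}\mathcal{K}\subset\mathcal{K}$ for all $t\ge 0$. The reachable cone is $\mathcal{K}_r(A,B):=\mathrm{cl}\,\mathrm{cone}\{e^{At}B: t\ge 0\}$, the closure of the convex conic hull of the trajectory. A cone is polyhedral if it equals $N\mathbb{R}^m_{\ge 0}$ for some $m$ and some $N\in\mathbb{R}^{3\times m}$. A second-order cone is a cone of the form $\{x:\|Px\|_2\le c^{\mathsf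 T}x\}$, equivalently represented as $\mathcal{K}_{K,c}=\{x: x^{\mathsf T}Kx\le 0,\ c^{\mathsf T}x\ge 0\}$ with $K=P^{\mathsf T}P-cc^{\mathsf T}$. *)

theory Defs
  imports "HOL-Analysis.Analysis"
begin

(* The type class multiplication on vec is componentwise, so powers of a matrix are
   iterates of the matrix product. *)
definition matrix_exp :: "real^'n^'n \<Rightarrow> real^'n^'n" where
  "matrix_exp A = (\<Sum>k. (1 / fact k) *\<^sub>R (((**) A ^^ k) (mat 1)))"

(* decreasing real part; for equal real parts, increasing imaginary part *)
definition eig_precedes :: "complex \<Rightarrow> complex \<Rightarrow> bool" where
  "eig_precedes z w \<longleftrightarrow> Re z > Re w \<or> (Re z = Re w \<and> Im z \<le> Im w)"

(* l1, l2, l3 are the eigenvalues of A, counted with algebraic multiplicity and ordered.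
   Since eig_precedes is a total order, A determines the triple. *)
definition ordered_eigenvalues ::
    "real^3^3 \<Rightarrow> complex \<Rightarrow> complex \<Rightarrow> complex \<Rightarrow> bool" where
  "ordered_eigenvalues A l1 l2 l3 \<longleftrightarrow>
     (\<forall>z. det (mat z - map_matrix complex_of_real A) = (z - l1) * (z - l2) * (z - l3)) \<and>
     eig_precedes l1 l2 \<and> eig_precedes l2 l3"

definition proper_convex_cone :: "(real^3) set \<Rightarrow> bool" where
  "proper_convex_cone K \<longleftrightarrow>
     convex_cone K \<and> closed K \<and> interior K \<noteq> {} \<and> K \<inter> uminus ` K = {0}"

definition invariant_for :: "real^3^3 \<Rightarrow> real^3 \<Rightarrow> (real^3) set \<Rightarrow> bool" where
  "invariant_for A B K \<longleftrightarrow>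
     B \<in> K \<and> (\<forall>t\<ge>0. (\<lambda>x. matrix_exp (t *\<^sub>R A) *v x) ` K \<subseteq> K)"

definition reachable_cone :: "real^3^3 \<Rightarrow> real^3 \<Rightarrow> (real^3) set" where
  "reachable_cone A B = closure (convex_cone hull {matrix_exp (t *\<^sub>R A) *v B | t. t \<ge> 0})"

(* N i, for i < m, are the columns of a 3 x m matrix. *)
definition polyhedral_cone :: "(real^3) set \<Rightarrow> bool" where
  "polyhedral_cone K \<longleftrightarrow>
     (\<exists>(m::nat) (N :: nat \<Rightarrow> real^3).
        K = {\<Sum>i<m. y i *\<^sub>R N i | y :: nat \<Rightarrow> real. \<forall>i<m. y i \<ge> 0})"

(* p i, for i < m, are the rows of a matrix P with any number m of rows,
   so the left-hand side is the Euclidean norm of P x. *)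
definition second_order_cone :: "(real^3) set \<Rightarrow> bool" where
  "second_order_cone K \<longleftrightarrow>
     (\<exists>(m::nat) (p :: nat \<Rightarrow> real^3) (c :: real^3).
        K = {x. L2_set (\<lambda>i. p i \<bullet> x) {..<m} \<le> c \<bullet> x})"

end

theory Submission
  imports Defs
begin

text \<open>
  \<^bold>\<open>Reduction to a plane spiral.\<close> The ordering of the eigenvalues makes the real one, \<open>lam\<close>,
  strictly dominant; the other two are \<open>lam + om * zeta\<close> and its conjugate, with \<open>om > 0\<close>,
  \<open>zeta = - r + \<i>\<close> and \<open>r > 0\<close>. A real left eigenvector gives a linear functional \<open>Z\<close>, a complex one
  a functional \<open>Y\<close>, and \<open>(Z, Y)\<close> is an isomorphism from \<open>real^3\<close> to \<open>real \<times> complex\<close> in which the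
  flow multiplies \<open>Z\<close> by \<open>exp (lam * t)\<close> and \<open>Y\<close> by \<open>exp (lam * t) * exp (zeta * om * t)\<close>. Positive
  factors do not matter for cones, so up to a change of time the trajectory of the point \<open>B\<close> with
  coordinates \<open>(1, 1)\<close> is the spiral \<open>(1, exp (zeta * t))\<close>, which tends to the axis point \<open>(1, 0)\<close>.

  \<^bold>\<open>The functional C.\<close> There is a turning angle \<open>a\<close> between \<open>pi\<close> and \<open>2 * pi\<close> such that the tangent
  of the spiral at time \<open>a\<close> passes through the starting point of the spiral. \<open>C\<close> is the functional
  that vanishes on this tangent line; it is nonnegative on the spiral. Moving it backwards along the
  flow yields the functionals \<open>psi u\<close>, with \<open>C = psi 0\<close>; for \<open>0 \<le> u \<le> a\<close> they describe the tangents at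
  all the points of the arc from time \<open>0\<close> to time \<open>a\<close>. An invariant set on which \<open>C\<close> is nonnegative
  therefore lies in the cone \<open>obs_cone\<close> on which all \<open>psi u\<close> are nonnegative. The section \<open>Z = 1\<close> of
  that cone is bounded by the arc and by the chord joining its end points, so every point of it is a
  convex combination of the axis point and points of the arc (\<open>obs_cone_cases\<close>). Hence it is contained
  in every closed convex cone containing the trajectory, and it equals the reachable cone
  (\<open>reachable_cone_eq\<close>).

  \<^bold>\<open>Not polyhedral.\<close> For \<open>0 < t < a\<close> the tangent at time \<open>t\<close> meets the cone only in the ray of
  \<open>spiral t\<close>, so these infinitely many rays would all have to occur among the generators.

  \<^bold>\<open>Not second-order, robustly.\<close> Let \<open>\<Delta>C\<close> be a small multiple \<open>\<eta>\<close> of \<open>Z\<close>. An invariant cone on which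
  \<open>C + \<eta> Z\<close> is nonnegative satisfies \<open>psi u + \<eta> Z \<ge> 0\<close> for all \<open>u \<ge> 0\<close>, and hence \<open>Z \<ge> 0\<close>.
  The functionals \<open>psi 0\<close> and \<open>psi a\<close> both vanish at \<open>B\<close>, where the section of the reachable cone has a
  corner. So the section of the invariant cone lies in a wedge whose tip is close to its point \<open>B\<close>,
  while it also contains the other end of the chord and the axis point. This is impossible for the
  section of a second-order cone: its quadratic form is positive semidefinite on the two planes
  bounding the wedge and on the plane \<open>Z = 0\<close>, it is nonpositive at the three points, and for small
  \<open>\<eta>\<close> these inequalities force it to vanish (\<open>almost_degenerate_bound\<close>,
  \<open>second_order_cone_avoids_wedge\<close>). The case \<open>\<eta> = 0\<close> says that the reachable cone itself is not
  second-order.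
\<close>

section \<open>The distance of a spiral from its tangent line\<close>

text \<open>
  \<open>gap r u\<close> measures, for the spiral with exponent \<open>zeta = - r + \<i>\<close>, how far the point at time
  \<open>t + u\<close> is from the tangent line at time \<open>t\<close>, on the side of the spiral's centre, and in units of
  the distance of the centre from that line; it does not depend on \<open>t\<close>.
\<close>

definition gap :: "real \<Rightarrow> real \<Rightarrow> real" where
  "gap r u = 1 - exp (- r * u) * (cos u + r * sin u)"

lemma gap_0 [simp]: "gap r 0 = 0"
  by (simp add: gap_def)

lemma gap_has_derivative:
  "(gap r has_real_derivative (1 + r\<^sup>2) * exp (- r * u) * sin u) (at u)"
proof -
  have "((\<lambda>u. 1 - exp (- r * u) * (cos u + r * sin u)) has_real_derivative
      (1 + r\<^sup>2) * exp (- r * u) * sin u) (at u)"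
    by (auto intro!: derivative_eq_intros simp: algebra_simps power2_eq_square)
  then show ?thesis by (simp add: gap_def[abs_def])
qed

lemma continuous_on_gap: "continuous_on S (gap r)"
  unfolding gap_def[abs_def] by (intro continuous_intros)

lemma gap_pos_right:
  assumes "0 < r" "0 < u"
  shows "0 < gap r u"
proof -
  have "cos u + r * sin u \<le> 1 + r * u"
    using assms sin_x_le_x[of u] cos_le_one[of u] by (intro add_mono mult_left_mono) auto
  also have "\<dots> < exp (r * u)"
    using exp_lower_Taylor_quadratic[of "r * u"] assms by (smt (verit) mult_pos_pos zero_less_power half_gt_zero)
  finally have "exp (- r * u) * (cos u + r * sin u) < exp (- r * u) * exp (r * u)"
    by (intro mult_strict_left_mono) auto
  then show ?thesis by (simp add: gap_def exp_minus)
qed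

text \<open>The tangent at time \<open>a\<close> passes through the point at time \<open>0\<close>.\<close>

lemma gap_left_root:
  assumes "0 < r"
  obtains a where "pi < a" "a < 2 * pi" "gap r (- a) = 0"
proof -
  have neg: "gap r (- (2 * pi)) < 0"
    using assms by (simp add: gap_def)
  have pos: "0 < gap r (- pi)"
    by (simp add: gap_def add_pos_pos)
  obtain x where x: "- (2 * pi) \<le> x" "x \<le> - pi" "gap r x = 0"
    using IVT'[of "gap r" "- (2 * pi)" 0 "- pi"] neg pos continuous_on_gap by fastforce
  have "x \<noteq> - (2 * pi)" "x \<noteq> - pi" using x neg pos by force+
  with x show ?thesis by (intro that[of "- x"]) auto
qed

text \<open>
  The derivative of the gap has the sign of the sine, so between \<open>- a\<close> and \<open>0\<close> the gap first
  increases from \<open>0\<close> and then decreases to \<open>0\<close>, with its maximum at \<open>- pi\<close>.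
\<close>

lemma gap_pos_left:
  assumes "gap r (- a) = 0" "pi < a" "a < 2 * pi" "- a < u" "u < 0"
  shows "0 < gap r u"
proof (cases "u < - pi")
  case True
  have "gap r (- a) < gap r u"
  proof (rule DERIV_pos_imp_increasing_open[OF \<open>- a < u\<close>])
    fix x assume x: "- a < x" "x < u"
    have "0 < sin (x + 2 * pi)" using x True assms by (intro sin_gt_zero) auto
    then have "0 < (1 + r\<^sup>2) * exp (- r * x) * sin x" by (simp add: sin_add add_pos_nonneg)
    then show "\<exists>y. (gap r has_real_derivative y) (at x) \<and> 0 < y"
      using gap_has_derivative by blast
  qed (rule continuous_on_gap)
  with assms show ?thesis by simp
next
  case False
  have "gap r u > gap r 0"
  proof (rule DERIV_neg_imp_decreasing_open[OF \<open>u < 0\<close>])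
    fix x assume x: "u < x" "x < 0"
    have "0 < sin (- x)" using x False by (intro sin_gt_zero) auto
    then have "(1 + r\<^sup>2) * exp (- r * x) * sin x < 0"
      by (simp add: mult_pos_neg add_pos_nonneg)
    then show "\<exists>y. (gap r has_real_derivative y) (at x) \<and> y < 0"
      using gap_has_derivative by blast
  qed (rule continuous_on_gap)
  then show ?thesis by simp
qed

lemma gap_nonneg:
  assumes "0 < r" "gap r (- a) = 0" "pi < a" "a < 2 * pi" "- a \<le> u"
  shows "0 \<le> gap r u"
proof -
  consider "u = - a" | "- a < u" "u < 0" | "u = 0" | "0 < u" using assms by linarith
  then show ?thesis
    by cases (use assms gap_pos_right[of r u] gap_pos_left[of r a u] in auto)
qed

lemma one_plus_Im_spiral:
  "1 + Im (cnj (Complex (- r) 1) * exp (Complex (- r) 1 * of_real u)) = gap r u"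
  by (simp add: gap_def Im_exp Re_exp algebra_simps)

section \<open>Second-order cones near a corner\<close>

text \<open>
  The symmetric bilinear form with matrix \<open>P\<^sup>T P - c c\<^sup>T\<close>, where \<open>p i\<close> for \<open>i < m\<close> are the rows of \<open>P\<close>.
  The second-order cone given by \<open>P\<close> and \<open>c\<close> is the part of \<open>{x. gram m p c x x \<le> 0}\<close> on which \<open>c\<close> is
  nonnegative.
\<close>

definition gram :: "nat \<Rightarrow> (nat \<Rightarrow> 'a::real_inner) \<Rightarrow> 'a \<Rightarrow> 'a \<Rightarrow> 'a \<Rightarrow> real" where
  "gram m p c x y = (\<Sum>i<m. (p i \<bullet> x) * (p i \<bullet> y)) - (c \<bullet> x) * (c \<bullet> y)"

lemma gram_commute: "gram m p c x y = gram m p c y x"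
  by (simp add: gram_def mult.commute)

lemma gram_add_right: "gram m p c x (y + z) = gram m p c x y + gram m p c x z"
  by (simp add: gram_def inner_add_right sum.distrib algebra_simps)

lemma gram_scaleR_right: "gram m p c x (s *\<^sub>R y) = s * gram m p c x y"
  by (simp add: gram_def sum_distrib_left algebra_simps)

lemma gram_add_left: "gram m p c (x + y) z = gram m p c x z + gram m p c y z"
  by (metis gram_add_right gram_commute)

lemma gram_scaleR_left: "gram m p c (s *\<^sub>R x) y = s * gram m p c x y"
  by (metis gram_scaleR_right gram_commute)

lemmas gram_simps = gram_add_left gram_add_right gram_scaleR_left gram_scaleR_right

lemma mem_second_order_cone_iff:
  "L2_set (\<lambda>i. p i \<bullet> x) {..<m} \<le> c \<bullet> x \<longleftrightarrow> gram m p c x x \<le> 0 \<and> 0 \<le> c \<bullet> x"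
proof -
  have "L2_set (\<lambda>i. p i \<bullet> x) {..<m} \<le> c \<bullet> x \<longleftrightarrow>
      0 \<le> c \<bullet> x \<and> (\<Sum>i<m. (p i \<bullet> x)\<^sup>2) \<le> (c \<bullet> x)\<^sup>2"
    unfolding L2_set_def
  proof -
    let ?s = "\<Sum>i<m. (p i \<bullet> x)\<^sup>2"
    have "0 \<le> sqrt ?s" by (simp add: sum_nonneg)
    then have "sqrt ?s \<le> c \<bullet> x \<Longrightarrow> 0 \<le> c \<bullet> x" by linarith
    then show "sqrt ?s \<le> c \<bullet> x \<longleftrightarrow> 0 \<le> c \<bullet> x \<and> ?s \<le> (c \<bullet> x)\<^sup>2"
      using real_le_lsqrt sqrt_le_D by blast
  qed
  then show ?thesis by (auto simp: gram_def power2_eq_square)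
qed

text \<open>
  If the form were negative at a point of the plane \<open>g = 0\<close>, then that point or its negative would
  be in the interior of the cone, and the cone would reach to the side \<open>g < 0\<close>.
\<close>

lemma gram_nonneg_on_supporting_plane:
  fixes g :: "'a::real_inner \<Rightarrow> real"
  assumes E: "\<And>x. gram m p c x x \<le> 0 \<Longrightarrow> 0 \<le> c \<bullet> x \<Longrightarrow> 0 \<le> g x"
    and g: "linear g" and e: "0 < g e" and v: "g v = 0"
  shows "0 \<le> gram m p c v v"
proof (rule ccontr)
  assume "\<not> 0 \<le> gram m p c v v"
  then have neg: "gram m p c v v < 0" by simp
  have False if w: "gram m p c w w < 0" "0 < c \<bullet> w" "g w = 0" for w
  proof -
    have "((\<lambda>d::real. gram m p c (w - d *\<^sub>R e) (w - d *\<^sub>R e)) \<longlongrightarrow>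
        gram m p c (w - 0 *\<^sub>R e) (w - 0 *\<^sub>R e)) (at_right 0)"
      unfolding gram_def by (intro tendsto_intros)
    then have 1: "\<forall>\<^sub>F d in at_right 0. gram m p c (w - d *\<^sub>R e) (w - d *\<^sub>R e) < 0"
      using w by (auto dest: order_tendstoD(2))
    have "((\<lambda>d::real. c \<bullet> (w - d *\<^sub>R e)) \<longlongrightarrow> c \<bullet> (w - 0 *\<^sub>R e)) (at_right 0)"
      by (intro tendsto_intros)
    then have 2: "\<forall>\<^sub>F d in at_right 0. 0 < c \<bullet> (w - d *\<^sub>R e)"
      using w by (auto dest: order_tendstoD(1))
    have 3: "\<forall>\<^sub>F d in at_right (0::real). 0 < d" by (rule eventually_at_right_less)
    obtain d where d: "gram m p c (w - d *\<^sub>R e) (w - d *\<^sub>R e) < 0"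
        "0 < c \<bullet> (w - d *\<^sub>R e)" "0 < d"
      using eventually_happens'[OF _ eventually_conj[OF 1 eventually_conj[OF 2 3]]]
      by (auto simp: trivial_limit_at_right_real)
    then have "0 \<le> g (w - d *\<^sub>R e)" using E by simp
    then have "d * g e \<le> 0" using w by (simp add: linear_diff[OF g] linear_scale[OF g])
    with d(3) e show False by (simp add: mult_le_0_iff)
  qed
  note no = this
  have "0 \<le> (\<Sum>i<m. (p i \<bullet> v) * (p i \<bullet> v))" by (intro sum_nonneg) simp
  then have "c \<bullet> v \<noteq> 0" using neg by (auto simp: gram_def)
  then consider "0 < c \<bullet> v" | "0 < c \<bullet> (- v)" by fastforce
  then show False
  proof cases
    case 1 then show ?thesis using no neg v by blast
  next
    case 2
    moreover have "gram m p c (- v) (- v) < 0" using neg by (simp add: gram_def)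
    ultimately show ?thesis using no[of "- v"] v by (simp add: linear_neg[OF g])
  qed
qed

text \<open>Cauchy-Schwarz for a positive semidefinite binary form.\<close>

lemma psd_form_bound:
  fixes a b d :: real
  assumes "\<And>s t. 0 \<le> s\<^sup>2 * a + 2 * s * t * d + t\<^sup>2 * b"
  shows "0 \<le> a" "0 \<le> b" "\<bar>d\<bar> \<le> sqrt a * sqrt b"
proof -
  show a: "0 \<le> a" using assms[of 1 0] by simp
  show b: "0 \<le> b" using assms[of 0 1] by simp
  have "d\<^sup>2 \<le> a * b"
  proof (cases "a = 0")
    case True
    have "d = 0"
    proof (rule ccontr)
      assume "d \<noteq> 0"
      then show False
        using assms[of "- (b + 1) / (2 * d)" 1] True by (simp add: field_simps)
    qed
    with True show ?thesis by simp
  next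
    case False
    have "0 \<le> a * (a * b - d\<^sup>2)"
      using assms[of "- d" a] by (simp add: algebra_simps power2_eq_square)
    then show ?thesis using a False by (simp add: zero_le_mult_iff)
  qed
  then show "\<bar>d\<bar> \<le> sqrt a * sqrt b"
    by (metis real_sqrt_abs real_sqrt_le_mono real_sqrt_mult)
qed

text \<open>
  A quadratic form \<open>f\<close> has the diagonal entries \<open>\<alpha>\<^sup>2\<close>, \<open>\<beta>\<^sup>2\<close>, \<open>\<gamma>\<^sup>2\<close> and the off-diagonal entries \<open>D\<close>, \<open>D'\<close>, \<open>G\<close>
  with respect to vectors \<open>w\<close>, \<open>ex\<close>, \<open>ev\<close>; it is positive semidefinite on the three coordinate planes.
  The hypotheses \<open>0\<close>, \<open>1\<close>, \<open>2\<close> say that \<open>f \<le> 0\<close> at the points \<open>w + \<eta> ex + \<eta> ev\<close>,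
  \<open>w + (\<mu> + \<eta>) ex + \<eta> ev\<close> and \<open>w + (1 + \<eta>) ex + (1 + \<eta>) ev\<close>. The first one makes \<open>\<alpha>\<close> small
  compared with \<open>\<sigma> = \<beta> + \<gamma>\<close>, then the second one makes \<open>\<beta>\<close> small, and the third one makes
  \<open>\<beta> - \<gamma>\<close> small. For small \<open>\<eta>\<close> this is only possible if \<open>\<sigma> = 0\<close>; the bound
  on \<open>\<eta>\<close> collects the constants of these estimates.
\<close>

lemma almost_degenerate_bound:
  fixes \<alpha> \<beta> \<gamma> D D' G \<eta> \<mu> :: real
  assumes nn: "0 \<le> \<alpha>" "0 \<le> \<beta>" "0 \<le> \<gamma>"
    and D: "\<bar>D\<bar> \<le> \<alpha> * \<beta>" and D': "\<bar>D'\<bar> \<le> \<alpha> * \<gamma>" and G: "\<bar>G\<bar> \<le> \<beta> * \<gamma>"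
    and \<eta>: "0 \<le> \<eta>" "\<eta> * (112 * (1 + \<mu>) / \<mu>\<^sup>2 + 12) < 1" and \<mu>: "0 < \<mu>"
    and 0: "\<alpha>\<^sup>2 + \<eta>\<^sup>2 * \<beta>\<^sup>2 + \<eta>\<^sup>2 * \<gamma>\<^sup>2 + 2 * \<eta> * D + 2 * \<eta> * D' + 2 * \<eta> * \<eta> * G \<le> 0"
    and 1: "\<alpha>\<^sup>2 + (\<mu> + \<eta>)\<^sup>2 * \<beta>\<^sup>2 + \<eta>\<^sup>2 * \<gamma>\<^sup>2
        + 2 * (\<mu> + \<eta>) * D + 2 * \<eta> * D' + 2 * (\<mu> + \<eta>) * \<eta> * G \<le> 0"
    and 2: "\<alpha>\<^sup>2 + (1 + \<eta>)\<^sup>2 * \<beta>\<^sup>2 + (1 + \<eta>)\<^sup>2 * \<gamma>\<^sup>2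
        + 2 * (1 + \<eta>) * D + 2 * (1 + \<eta>) * D' + 2 * (1 + \<eta>) * (1 + \<eta>) * G \<le> 0"
  shows "\<alpha> = 0" "\<beta> = 0" "\<gamma> = 0"
proof -
  define \<sigma> where "\<sigma> = \<beta> + \<gamma>"
  have \<sigma>0: "0 \<le> \<sigma>" using nn by (simp add: \<sigma>_def)
  have "\<eta> * 12 \<le> \<eta> * (112 * (1 + \<mu>) / \<mu>\<^sup>2 + 12)"
    using \<eta> \<mu> by (intro mult_left_mono) auto
  then have \<eta>1: "\<eta> \<le> 1" using \<eta> by linarith
  have lower: "- (s * e) \<le> s * x" if "\<bar>x\<bar> \<le> e" "0 \<le> s" for s x e :: real
    using that by (metis abs_le_iff minus_le_iff mult_left_mono mult_minus_right)
  have prods: "\<alpha> * \<beta> + \<alpha> * \<gamma> = \<alpha> * \<sigma>" "\<alpha> * \<beta> \<le> \<alpha> * \<sigma>" "\<alpha> * \<gamma> \<le> \<alpha> * \<sigma>" "2 * (\<beta> * \<gamma>) \<le> \<sigma>\<^sup>2"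
    using nn by (auto simp: \<sigma>_def algebra_simps power2_eq_square)
  have \<alpha>: "\<alpha> \<le> 3 * \<eta> * \<sigma>"
  proof (rule ccontr)
    assume "\<not> \<alpha> \<le> 3 * \<eta> * \<sigma>"
    then have gt: "3 * \<eta> * \<sigma> < \<alpha>" by simp
    have "0 \<le> \<eta> * \<sigma>" using \<eta> \<sigma>0 by simp
    have "\<alpha>\<^sup>2 \<le> 2 * \<eta> * (\<alpha> * \<beta>) + 2 * \<eta> * (\<alpha> * \<gamma>) + 2 * \<eta> * \<eta> * (\<beta> * \<gamma>)"
      using 0 lower[OF D, of "2 * \<eta>"] lower[OF D', of "2 * \<eta>"] lower[OF G, of "2 * \<eta> * \<eta>"] \<eta>
        zero_le_power2[of "\<eta> * \<beta>"] zero_le_power2[of "\<eta> * \<gamma>"]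
      unfolding power_mult_distrib by (smt (verit) mult_nonneg_nonneg)
    also have "\<dots> \<le> 2 * \<eta> * (\<alpha> * \<sigma>) + \<eta> * \<eta> * \<sigma>\<^sup>2"
      using mult_left_mono[OF prods(4), of "\<eta> * \<eta>"] \<eta> prods(1) by (simp add: algebra_simps flip: prods(1))
    finally have "\<alpha> * (\<alpha> - 2 * (\<eta> * \<sigma>)) \<le> (\<eta> * \<sigma>) * (\<eta> * \<sigma>)"
      by (simp add: algebra_simps power2_eq_square)
    moreover have "(\<eta> * \<sigma>) * (\<eta> * \<sigma>) < \<alpha> * (\<alpha> - 2 * (\<eta> * \<sigma>))"
      using gt \<open>0 \<le> \<eta> * \<sigma>\<close> by (intro mult_le_less_imp_less mult_strict_mono') auto
    ultimately show False by simp
  qed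
  have \<alpha>\<sigma>: "\<alpha> * \<sigma> \<le> 3 * \<eta> * \<sigma>\<^sup>2"
    using mult_right_mono[OF \<alpha> \<sigma>0] by (simp add: power2_eq_square mult.assoc)
  have \<beta>: "\<mu>\<^sup>2 * \<beta>\<^sup>2 \<le> 14 * (1 + \<mu>) * \<eta> * \<sigma>\<^sup>2"
  proof -
    have "\<mu>\<^sup>2 * \<beta>\<^sup>2 \<le> (\<mu> + \<eta>)\<^sup>2 * \<beta>\<^sup>2"
      using \<mu> \<eta> by (intro mult_right_mono power_mono) auto
    also have "\<dots> \<le> 2 * (\<mu> + \<eta>) * (\<alpha> * \<beta>) + 2 * \<eta> * (\<alpha> * \<gamma>) + 2 * (\<mu> + \<eta>) * \<eta> * (\<beta> * \<gamma>)"
      using 1 lower[OF D, of "2 * (\<mu> + \<eta>)"] lower[OF D', of "2 * \<eta>"]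
        lower[OF G, of "2 * (\<mu> + \<eta>) * \<eta>"] \<eta> \<mu> zero_le_power2[of "\<eta> * \<gamma>"] zero_le_power2[of \<alpha>]
      unfolding power_mult_distrib by (smt (verit) mult_nonneg_nonneg)
    also have "\<dots> \<le> 2 * (1 + \<mu>) * (3 * \<eta> * \<sigma>\<^sup>2) + 2 * (1 + \<mu>) * (3 * \<eta> * \<sigma>\<^sup>2) + (1 + \<mu>) * \<eta> * \<sigma>\<^sup>2"
    proof (intro add_mono)
      have "\<alpha> * \<beta> \<le> 3 * \<eta> * \<sigma>\<^sup>2" "\<alpha> * \<gamma> \<le> 3 * \<eta> * \<sigma>\<^sup>2" using prods \<alpha>\<sigma> by linarith+
      then show "2 * (\<mu> + \<eta>) * (\<alpha> * \<beta>) \<le> 2 * (1 + \<mu>) * (3 * \<eta> * \<sigma>\<^sup>2)"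
        "2 * \<eta> * (\<alpha> * \<gamma>) \<le> 2 * (1 + \<mu>) * (3 * \<eta> * \<sigma>\<^sup>2)"
        using nn \<mu> \<eta> \<eta>1 by (auto intro!: mult_mono)
      have "(\<mu> + \<eta>) * \<eta> * (2 * (\<beta> * \<gamma>)) \<le> (1 + \<mu>) * \<eta> * \<sigma>\<^sup>2"
        using prods \<mu> \<eta> \<eta>1 nn by (intro mult_mono) auto
      then show "2 * (\<mu> + \<eta>) * \<eta> * (\<beta> * \<gamma>) \<le> (1 + \<mu>) * \<eta> * \<sigma>\<^sup>2" by (simp add: mult_ac)
    qed
    also have "\<dots> = 13 * ((1 + \<mu>) * \<eta> * \<sigma>\<^sup>2)" by (simp add: algebra_simps)
    also have "\<dots> \<le> 14 * ((1 + \<mu>) * \<eta> * \<sigma>\<^sup>2)" using \<mu> \<eta> by (intro mult_right_mono) auto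
    finally show ?thesis by (simp add: algebra_simps)
  qed
  have diff: "(\<beta> - \<gamma>)\<^sup>2 \<le> 6 * \<eta> * \<sigma>\<^sup>2"
  proof -
    have "(1 + \<eta>)\<^sup>2 * (\<beta> - \<gamma>)\<^sup>2 =
        (1 + \<eta>)\<^sup>2 * \<beta>\<^sup>2 + (1 + \<eta>)\<^sup>2 * \<gamma>\<^sup>2 - 2 * (1 + \<eta>) * (1 + \<eta>) * (\<beta> * \<gamma>)"
      by (simp add: power2_eq_square algebra_simps)
    also have "\<dots> \<le> 2 * (1 + \<eta>) * (\<alpha> * \<beta>) + 2 * (1 + \<eta>) * (\<alpha> * \<gamma>)"
      using 2 lower[OF D, of "2 * (1 + \<eta>)"] lower[OF D', of "2 * (1 + \<eta>)"]
        lower[OF G, of "2 * (1 + \<eta>) * (1 + \<eta>)"] \<eta> zero_le_power2[of \<alpha>]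
      by (smt (verit) mult_nonneg_nonneg)
    also have "\<dots> = (1 + \<eta>) * (2 * (\<alpha> * \<sigma>))" by (simp flip: prods(1) add: algebra_simps)
    finally have "(1 + \<eta>) * ((1 + \<eta>) * (\<beta> - \<gamma>)\<^sup>2) \<le> (1 + \<eta>) * (2 * (\<alpha> * \<sigma>))"
      by (simp add: power2_eq_square mult.assoc)
    then have "(1 + \<eta>) * (\<beta> - \<gamma>)\<^sup>2 \<le> 2 * (\<alpha> * \<sigma>)"
      using \<eta> by (subst (asm) mult_le_cancel_left_pos) auto
    moreover have "(\<beta> - \<gamma>)\<^sup>2 \<le> (1 + \<eta>) * (\<beta> - \<gamma>)\<^sup>2" using \<eta> by (simp add: algebra_simps)
    ultimately show ?thesis using \<alpha>\<sigma> by linarith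
  qed
  have "\<sigma>\<^sup>2 \<le> 8 * \<beta>\<^sup>2 + 2 * (\<beta> - \<gamma>)\<^sup>2"
  proof -
    have "8 * \<beta>\<^sup>2 + 2 * (\<beta> - \<gamma>)\<^sup>2 - \<sigma>\<^sup>2 = (3 * \<beta> - \<gamma>)\<^sup>2"
      by (simp add: \<sigma>_def power2_eq_square algebra_simps)
    then show ?thesis by (metis diff_ge_0_iff_ge zero_le_power2)
  qed
  also have "\<dots> \<le> 8 * (14 * (1 + \<mu>) * \<eta> * \<sigma>\<^sup>2 / \<mu>\<^sup>2) + 2 * (6 * \<eta> * \<sigma>\<^sup>2)"
  proof -
    have "\<beta>\<^sup>2 \<le> 14 * (1 + \<mu>) * \<eta> * \<sigma>\<^sup>2 / \<mu>\<^sup>2"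
      using \<beta> \<mu> by (simp add: pos_le_divide_eq mult.commute)
    with diff show ?thesis by linarith
  qed
  also have "\<dots> = \<eta> * (112 * (1 + \<mu>) / \<mu>\<^sup>2 + 12) * \<sigma>\<^sup>2"
    by (simp add: algebra_simps)
  finally have "(1 - \<eta> * (112 * (1 + \<mu>) / \<mu>\<^sup>2 + 12)) * \<sigma>\<^sup>2 \<le> 0"
    by (simp add: algebra_simps)
  then have "\<sigma>\<^sup>2 \<le> 0" using \<eta> by (simp add: mult_le_0_iff)
  then have "\<sigma> = 0" by simp
  then show "\<beta> = 0" "\<gamma> = 0" using nn by (auto simp: \<sigma>_def)
  show "\<alpha> = 0" using \<alpha> \<open>\<sigma> = 0\<close> nn by simp
qed

lemma gram_expand3:
  "gram m p c (w + s *\<^sub>R x + t *\<^sub>R y) (w + s *\<^sub>R x + t *\<^sub>R y) =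
    gram m p c w w + s\<^sup>2 * gram m p c x x + t\<^sup>2 * gram m p c y y
    + 2 * s * gram m p c w x + 2 * t * gram m p c w y + 2 * s * t * gram m p c x y"
  unfolding gram_simps gram_commute[of m p c x w] gram_commute[of m p c y w]
    gram_commute[of m p c y x]
  by (simp add: power2_eq_square algebra_simps)

lemma gram_expand2:
  "gram m p c (s *\<^sub>R x + t *\<^sub>R y) (s *\<^sub>R x + t *\<^sub>R y) =
    s\<^sup>2 * gram m p c x x + 2 * s * t * gram m p c x y + t\<^sup>2 * gram m p c y y"
  unfolding gram_simps gram_commute[of m p c y x]
  by (simp add: power2_eq_square algebra_simps)

text \<open>
  In the coordinates \<open>(Z, X, V)\<close> the points \<open>b0\<close>, \<open>b1\<close>, \<open>b2\<close> are \<open>(1, 0, 0)\<close>, \<open>(1, \<mu>, 0)\<close> and \<open>(1, 1, 1)\<close>.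
  The wedge \<open>X + \<eta> Z \<ge> 0\<close>, \<open>V + \<eta> Z \<ge> 0\<close> has its tip at \<open>w = (1, - \<eta>, - \<eta>)\<close>, close to \<open>b0\<close>.
\<close>

lemma second_order_cone_avoids_wedge:
  fixes X V Z :: "real^3 \<Rightarrow> real" and E :: "(real^3) set"
  assumes lin: "linear X" "linear V" "linear Z"
    and E: "second_order_cone E" and mem: "b0 \<in> E" "b1 \<in> E" "b2 \<in> E"
    and b0: "Z b0 = 1" "X b0 = 0" "V b0 = 0"
    and b1: "Z b1 = 1" "X b1 = \<mu>" "V b1 = 0"
    and b2: "Z b2 = 1" "X b2 = 1" "V b2 = 1"
    and \<mu>: "0 < \<mu>" and \<eta>: "0 \<le> \<eta>" "\<eta> * (112 * (1 + \<mu>) / \<mu>\<^sup>2 + 12) < 1"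
    and sub: "\<And>x. x \<in> E \<Longrightarrow> 0 \<le> Z x" "\<And>x. x \<in> E \<Longrightarrow> 0 \<le> X x + \<eta> * Z x"
      "\<And>x. x \<in> E \<Longrightarrow> 0 \<le> V x + \<eta> * Z x"
  shows False
proof -
  from E obtain m :: nat and p c where "E = {x. L2_set (\<lambda>i. p i \<bullet> x) {..<m} \<le> c \<bullet> x}"
    unfolding second_order_cone_def by auto
  then have E_iff: "x \<in> E \<longleftrightarrow> gram m p c x x \<le> 0 \<and> 0 \<le> c \<bullet> x" for x
    by (simp add: mem_second_order_cone_iff)
  note lin_simps = linear_add[OF lin(1)] linear_add[OF lin(2)] linear_add[OF lin(3)]
    linear_diff[OF lin(1)] linear_diff[OF lin(2)] linear_diff[OF lin(3)]
    linear_scale[OF lin(1)] linear_scale[OF lin(2)] linear_scale[OF lin(3)]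
  define ex where "ex = (1 / \<mu>) *\<^sub>R (b1 - b0)"
  define ev where "ev = b2 - b0 - ex"
  define w where "w = b0 - \<eta> *\<^sub>R ex - \<eta> *\<^sub>R ev"
  have ex: "Z ex = 0" "X ex = 1" "V ex = 0" using \<mu> b0 b1 by (auto simp: ex_def lin_simps)
  have ev: "Z ev = 0" "X ev = 0" "V ev = 1" using b0 b2 ex by (auto simp: ev_def lin_simps)
  have w: "Z w = 1" "X w = - \<eta>" "V w = - \<eta>" using b0 ex ev by (auto simp: w_def lin_simps)
  have b_eq: "b0 = w + \<eta> *\<^sub>R ex + \<eta> *\<^sub>R ev" "b1 = w + (\<mu> + \<eta>) *\<^sub>R ex + \<eta> *\<^sub>R ev"
    "b2 = w + (1 + \<eta>) *\<^sub>R ex + (1 + \<eta>) *\<^sub>R ev"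
  proof -
    have "b1 = b0 + \<mu> *\<^sub>R ex" using \<mu> by (simp add: ex_def)
    then show "b0 = w + \<eta> *\<^sub>R ex + \<eta> *\<^sub>R ev" "b1 = w + (\<mu> + \<eta>) *\<^sub>R ex + \<eta> *\<^sub>R ev"
      "b2 = w + (1 + \<eta>) *\<^sub>R ex + (1 + \<eta>) *\<^sub>R ev"
      by (simp_all add: w_def ev_def algebra_simps)
  qed
  let ?b = "gram m p c"
  have lin': "linear (\<lambda>x. X x + \<eta> * Z x)" "linear (\<lambda>x. V x + \<eta> * Z x)"
    by (auto intro!: linearI simp: lin_simps algebra_simps)
  \<comment> \<open>The planes spanned by \<open>w, ex\<close>, by \<open>w, ev\<close> and by \<open>ex, ev\<close> bound the three half-spaces containing \<open>E\<close>.\<close>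
  have plane1: "0 \<le> s\<^sup>2 * ?b w w + 2 * s * t * ?b w ex + t\<^sup>2 * ?b ex ex" for s t
    unfolding gram_expand2[symmetric]
    by (rule gram_nonneg_on_supporting_plane[of m p c "\<lambda>x. V x + \<eta> * Z x" ev])
      (use sub E_iff lin' in \<open>auto simp: lin_simps w ex ev\<close>)
  have plane2: "0 \<le> s\<^sup>2 * ?b w w + 2 * s * t * ?b w ev + t\<^sup>2 * ?b ev ev" for s t
    unfolding gram_expand2[symmetric]
    by (rule gram_nonneg_on_supporting_plane[of m p c "\<lambda>x. X x + \<eta> * Z x" ex])
      (use sub E_iff lin' in \<open>auto simp: lin_simps w ex ev\<close>)
  have plane3: "0 \<le> s\<^sup>2 * ?b ex ex + 2 * s * t * ?b ex ev + t\<^sup>2 * ?b ev ev" for s t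
    unfolding gram_expand2[symmetric]
    by (rule gram_nonneg_on_supporting_plane[of m p c Z w])
      (use sub E_iff lin in \<open>auto simp: lin_simps w ex ev\<close>)
  note p1 = psd_form_bound[OF plane1] and p2 = psd_form_bound[OF plane2]
    and p3 = psd_form_bound[OF plane3]
  have zero: "sqrt (?b w w) = 0" "sqrt (?b ex ex) = 0" "sqrt (?b ev ev) = 0"
  proof -
    have le: "?b b0 b0 \<le> 0" "?b b1 b1 \<le> 0" "?b b2 b2 \<le> 0" using mem E_iff by auto
    have sq: "(sqrt (?b w w))\<^sup>2 = ?b w w" "(sqrt (?b ex ex))\<^sup>2 = ?b ex ex"
      "(sqrt (?b ev ev))\<^sup>2 = ?b ev ev"
      using p1 p2 by auto
    note * = almost_degenerate_bound[of "sqrt (?b w w)" "sqrt (?b ex ex)" "sqrt (?b ev ev)"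
        "?b w ex" "?b w ev" "?b ex ev" \<eta> \<mu>, unfolded sq]
    show "sqrt (?b w w) = 0" "sqrt (?b ex ex) = 0" "sqrt (?b ev ev) = 0"
      by (rule *; use p1 p2 p3 \<mu> \<eta> le[unfolded b_eq gram_expand3] in \<open>simp\<close>)+
  qed
  have "?b ex ex = 0" "?b ex ev = 0" "?b ev ev = 0"
    using zero p3 by auto
  \<comment> \<open>The form vanishes on the span of \<open>ex\<close> and \<open>ev\<close>, so \<open>E\<close> contains this whole plane up to sign.\<close>
  then have zero': "?b (s *\<^sub>R ex + t *\<^sub>R ev) (s *\<^sub>R ex + t *\<^sub>R ev) = 0" for s t
    unfolding gram_expand2 by simp
  have "?b (ex - ev) (ex - ev) = 0" "?b (ev - ex) (ev - ex) = 0"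
    using zero'[of 1 "-1"] zero'[of "-1" 1] by auto
  then have "ex - ev \<in> E \<or> ev - ex \<in> E"
    unfolding E_iff by (auto simp: inner_diff_right)
  moreover have "ex - ev \<notin> E" "ev - ex \<notin> E"
    using sub(2)[of "ev - ex"] sub(3)[of "ex - ev"] by (auto simp: lin_simps ex ev)
  ultimately show False by blast
qed

section \<open>The reachable cone of a spiral\<close>

lemma invariant_forD:
  "invariant_for A B K \<Longrightarrow> x \<in> K \<Longrightarrow> 0 \<le> t \<Longrightarrow> matrix_exp (t *\<^sub>R A) *v x \<in> K"
  by (auto simp: invariant_for_def image_subset_iff)

lemma linear_functional_inner:
  fixes g :: "'a::euclidean_space \<Rightarrow> real"
  assumes "linear g"
  obtains c where "\<And>x. c \<bullet> x = g x"
proof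
  fix x
  show "adjoint g 1 \<bullet> x = g x" using adjoint_works[OF assms, of x 1] by (simp add: inner_commute)
qed

text \<open>
  If a supporting functional vanishes at a nonzero element of a finitely generated cone, then it
  vanishes at one of the generators.
\<close>

lemma finitely_generated_halfspace_zero:
  assumes "x = (\<Sum>i<m. y i *\<^sub>R N i)" "\<forall>i<m. (0::real) \<le> y i" "x \<noteq> 0"
    and "linear g" "g x = (0::real)" "\<And>i. i < m \<Longrightarrow> 0 \<le> g (N i)"
  obtains i where "i < (m::nat)" "N i \<noteq> (0::'a::real_vector)" "g (N i) = 0"
proof -
  have "\<exists>i<m. y i *\<^sub>R N i \<noteq> 0"
    using assms(1,3) by (metis (mono_tags, lifting) lessThan_iff sum.neutral)
  then obtain i where i: "i < m" "y i \<noteq> 0" "N i \<noteq> 0" by auto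
  have "(\<Sum>i<m. y i * g (N i)) = 0"
    using assms(1,5) by (simp add: linear_sum[OF assms(4)] linear_scale[OF assms(4)])
  then have "y i * g (N i) = 0"
    using sum_nonneg_eq_0_iff[of "{..<m}" "\<lambda>i. y i * g (N i)"] assms(2,6) i(1) by auto
  with i that show ?thesis by auto
qed

text \<open>
  A ray from the centre meets either the arc of the spiral between the times \<open>0\<close> and \<open>a\<close>, or the
  chord joining the end points \<open>1\<close> and \<open>exp (zeta * a)\<close> of the arc. As \<open>a > pi\<close>, the chord is seen
  under an angle less than \<open>pi\<close>, so in the second case the ray is in the convex cone of the end points.
\<close>

lemma polar_or_chord:
  fixes y :: complex
  assumes "y \<noteq> 0" "pi < a" "a < 2 * pi"
  obtains (arc) s \<phi> where "0 < s" "0 \<le> \<phi>" "\<phi> \<le> a" "y = s *\<^sub>R exp (Complex (- r) 1 * of_real \<phi>)"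
  | (chord) p q where "0 \<le> p" "0 \<le> q" "y = p *\<^sub>R 1 + q *\<^sub>R exp (Complex (- r) 1 * of_real a)"
proof -
  have spiral: "exp (Complex (- r) 1 * of_real t) = exp (- r * t) *\<^sub>R cis t" for t
    by (simp add: complex_eq_iff Re_exp Im_exp)
  have unspiral: "s *\<^sub>R cis t = (s * exp (r * t)) *\<^sub>R exp (Complex (- r) 1 * of_real t)" for s t
    unfolding spiral by (simp add: exp_minus)
  define \<phi> where "\<phi> = Arg2pi y"
  have \<phi>: "0 \<le> \<phi>" "\<phi> < 2 * pi" "y = cmod y *\<^sub>R cis \<phi>"
    using Arg2pi[of y] by (auto simp: \<phi>_def is_Arg_def cis_conv_exp scaleR_conv_of_real)
  show ?thesis
  proof (cases "\<phi> \<le> a")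
    case True
    with \<phi> assms(1) show ?thesis
      by (intro arc[of "cmod y * exp (r * \<phi>)" \<phi>]) (auto simp flip: unspiral)
  next
    case False
    define k u v where "k = sin (2 * pi - a)" and "u = sin (\<phi> - a)" and "v = sin (2 * pi - \<phi>)"
    have S: "0 < k" "0 < u" "0 < v"
      unfolding k_def u_def v_def using assms False \<phi> by (intro sin_gt_zero; linarith)+
    \<comment> \<open>the sine rule, with \<open>1 = cis (2 * pi)\<close>\<close>
    have "k *\<^sub>R cis \<phi> = u *\<^sub>R 1 + v *\<^sub>R cis a"
      unfolding k_def u_def v_def by (simp add: complex_eq_iff sin_diff)
    then have "(1 / k) *\<^sub>R k *\<^sub>R cis \<phi> = (u / k) *\<^sub>R 1 + (v / k) *\<^sub>R cis a"
      by (simp add: scaleR_add_right)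
    then have "cis \<phi> = (u / k) *\<^sub>R 1 + (v / k) *\<^sub>R cis a" using S by simp
    then have "y = (cmod y * u / k) *\<^sub>R 1 + (cmod y * v / k) *\<^sub>R cis a"
      by (subst \<phi>(3)) (simp add: scaleR_add_right)
    then show ?thesis
      unfolding unspiral using S
      by (intro chord) auto
  qed
qed

text \<open>
  The functionals \<open>Z\<close> and \<open>Y\<close> are coordinates on \<open>real^3\<close> with values in \<open>real\<close> and \<open>complex\<close>, and
  \<open>pt z y\<close> is the point with coordinates \<open>z\<close> and \<open>y\<close>. The flow acts by the real eigenvalue \<open>lam\<close> on
  \<open>Z\<close> and by the eigenvalue \<open>lam + om * (- r + \<i>)\<close> on \<open>Y\<close>. The number \<open>a\<close> is the time at which the
  tangent of the spiral passes through the starting point.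
\<close>

locale spiral_flow =
  fixes A :: "real^3^3" and Z :: "real^3 \<Rightarrow> real" and Y :: "real^3 \<Rightarrow> complex"
    and pt :: "real \<Rightarrow> complex \<Rightarrow> real^3" and lam om r a :: real
  assumes linear_Z: "linear Z" and linear_Y: "linear Y"
    and Z_pt [simp]: "Z (pt z y) = z" and Y_pt [simp]: "Y (pt z y) = y"
    and pt_coords: "pt (Z x) (Y x) = x"
    and om_pos: "0 < om" and r_pos: "0 < r"
    and a_bounds: "pi < a" "a < 2 * pi" and gap_a: "gap r (- a) = 0"
    and Z_flow: "Z (matrix_exp (t *\<^sub>R A) *v x) = exp (lam * t) * Z x"
    and Y_flow: "Y (matrix_exp (t *\<^sub>R A) *v x) =
          exp (lam * t) *\<^sub>R (exp (Complex (- r) 1 * of_real (om * t)) * Y x)"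
begin

definition zeta :: complex where "zeta = Complex (- r) 1"

text \<open>
  The trajectory of \<open>spiral 0\<close> normalised to \<open>Z = 1\<close>, with time rescaled so that the angular velocity
  is one.
\<close>

definition spiral :: "real \<Rightarrow> real^3" where "spiral t = pt 1 (exp (zeta * of_real t))"

text \<open>
  \<open>psi 0\<close> vanishes on the tangent of the spiral at time \<open>a\<close>, and \<open>psi u\<close> is its pull-back along the
  normalised flow for time \<open>u\<close>; so \<open>psi u\<close> belongs to the tangent at time \<open>a - u\<close>. The
  normalisation is \<open>psi u (pt 1 0) = 1\<close>.
\<close>

definition psi :: "real \<Rightarrow> real^3 \<Rightarrow> real" where
  "psi u x = Z x + Im (cnj zeta * exp (zeta * of_real (u - a)) * Y x)"

text \<open>
  The largest subset of the half-space \<open>psi 0 \<ge> 0\<close> that is invariant under the flow.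
\<close>

definition obs_cone :: "(real^3) set" where
  "obs_cone = {x. \<forall>u\<ge>0. 0 \<le> psi u x}"

lemma coords_eqI: "Z x = Z x' \<Longrightarrow> Y x = Y x' \<Longrightarrow> x = x'"
  by (metis pt_coords)

lemmas ZY_simps = linear_add[OF linear_Z] linear_add[OF linear_Y]
    linear_diff[OF linear_Z] linear_diff[OF linear_Y]
    linear_scale[OF linear_Z] linear_scale[OF linear_Y]
    linear_0[OF linear_Z] linear_0[OF linear_Y]

lemma linear_psi: "linear (psi u)"
  by (auto intro!: linearI simp: psi_def ZY_simps algebra_simps)

lemmas psi_simps = linear_add[OF linear_psi] linear_scale[OF linear_psi] linear_0[OF linear_psi]

lemma Z_spiral [simp]: "Z (spiral t) = 1" and Y_spiral [simp]: "Y (spiral t) = exp (zeta * of_real t)"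
  by (simp_all add: spiral_def)

lemma psi_axis [simp]: "psi u (pt z 0) = z"
  by (simp add: psi_def)

lemma psi_spiral: "psi u (spiral t) = gap r (u + t - a)"
proof -
  have "exp (zeta * of_real (u - a)) * exp (zeta * of_real t) = exp (zeta * of_real (u + t - a))"
    by (simp flip: exp_add) (simp add: algebra_simps)
  moreover have "psi u (spiral t) =
      1 + Im (cnj zeta * (exp (zeta * of_real (u - a)) * exp (zeta * of_real t)))"
    unfolding psi_def Z_spiral Y_spiral by (simp only: mult.assoc)
  ultimately show ?thesis by (simp only: zeta_def one_plus_Im_spiral)
qed

lemma psi_flow: "psi u (matrix_exp (t *\<^sub>R A) *v x) = exp (lam * t) * psi (u + om * t) x"
proof -
  have "exp (zeta * of_real (u - a)) * exp (zeta * of_real (om * t)) = exp (zeta * of_real (u + om * t - a))"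
    by (simp flip: exp_add) (simp add: algebra_simps)
  then have *: "cnj zeta * exp (zeta * of_real (u - a)) * (exp (zeta * of_real (om * t)) * Y x)
      = cnj zeta * exp (zeta * of_real (u + om * t - a)) * Y x"
    by (metis mult.assoc)
  have "psi u (matrix_exp (t *\<^sub>R A) *v x) = exp (lam * t) * Z x
      + exp (lam * t) * Im (cnj zeta * exp (zeta * of_real (u - a)) * (exp (zeta * of_real (om * t)) * Y x))"
    unfolding psi_def Z_flow Y_flow zeta_def[symmetric] mult_scaleR_right by simp
  then show ?thesis unfolding * by (simp add: psi_def algebra_simps)
qed

lemma flow_spiral: "matrix_exp (t *\<^sub>R A) *v spiral 0 = exp (lam * t) *\<^sub>R spiral (om * t)"
  by (rule coords_eqI) (simp_all add: Z_flow Y_flow ZY_simps zeta_def)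

lemma norm_exp_zeta: "cmod (exp (zeta * of_real t)) = exp (- r * t)"
  by (simp add: zeta_def)

lemma exp_zeta_tendsto_0: "((\<lambda>t. exp (zeta * of_real t)) \<longlongrightarrow> 0) at_top"
proof (rule tendsto_norm_zero_cancel)
  have "((\<lambda>t. exp (- r * t)) \<longlongrightarrow> 0) at_top"
    using r_pos by (intro filterlim_compose[OF exp_at_bot] filterlim_tendsto_neg_mult_at_bot[of _ "- r"]
        tendsto_const filterlim_ident) auto
  then show "((\<lambda>t. cmod (exp (zeta * of_real t))) \<longlongrightarrow> 0) at_top"
    by (simp only: norm_exp_zeta)
qed

lemma spiral_tendsto_axis: "(spiral \<longlongrightarrow> pt 1 0) at_top"
proof -
  have eq: "spiral t = pt 1 0 + Re (exp (zeta * of_real t)) *\<^sub>R pt 0 1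
      + Im (exp (zeta * of_real t)) *\<^sub>R pt 0 \<i>" for t
    by (rule coords_eqI) (simp_all add: ZY_simps complex_eq_iff)
  have "((\<lambda>t. pt 1 0 + Re (exp (zeta * of_real t)) *\<^sub>R pt 0 1
      + Im (exp (zeta * of_real t)) *\<^sub>R pt 0 \<i>) \<longlongrightarrow>
      pt 1 0 + Re 0 *\<^sub>R pt 0 1 + Im 0 *\<^sub>R pt 0 \<i>) at_top"
    by (intro tendsto_intros exp_zeta_tendsto_0)
  then show ?thesis by (simp add: eq[abs_def])
qed

lemma psi_tendsto_Z: "((\<lambda>u. psi u x) \<longlongrightarrow> Z x) at_top"
proof -
  have "filterlim (\<lambda>u. u - a) at_top at_top"
    using filterlim_tendsto_add_at_top[OF tendsto_const[of "- a"] filterlim_ident] by simp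
  then have "((\<lambda>u. exp (zeta * of_real (u - a))) \<longlongrightarrow> 0) at_top"
    by (rule filterlim_compose[OF exp_zeta_tendsto_0])
  then have "((\<lambda>u. Z x + Im (cnj zeta * exp (zeta * of_real (u - a)) * Y x)) \<longlongrightarrow>
      Z x + Im (cnj zeta * 0 * Y x)) at_top"
    by (intro tendsto_intros)
  then show ?thesis by (simp add: psi_def[abs_def])
qed

lemma spiral_in_obs_cone: "0 \<le> t \<Longrightarrow> spiral t \<in> obs_cone"
  using gap_nonneg[OF r_pos gap_a a_bounds] by (simp add: obs_cone_def psi_spiral)

lemma closed_obs_cone: "closed obs_cone"
proof -
  have "obs_cone = (\<Inter>u\<in>{0..}. {x. 0 \<le> psi u x})" by (auto simp: obs_cone_def)
  moreover have "closed {x. 0 \<le> psi u x}" for u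
    by (intro closed_Collect_le continuous_intros linear_continuous_on
        linear_conv_bounded_linear[THEN iffD1] linear_psi)
  ultimately show ?thesis by (simp add: closed_INT)
qed

lemma convex_cone_obs_cone: "convex_cone obs_cone"
  by (simp add: convex_cone_iff obs_cone_def psi_simps)

text \<open>
  Only the tangents at the points of the arc are needed: for a point in the direction of the arc at
  time \<open>\<phi>\<close>, the tangent at time \<open>\<phi>\<close> bounds the distance from the centre; in the direction of the
  chord the tangent at time \<open>a\<close>, which contains the chord, does so.
\<close>

lemma obs_cone_cases:
  assumes "x \<in> obs_cone"
  obtains (arc) c d \<phi> where "0 \<le> c" "0 \<le> d" "0 \<le> \<phi>" "\<phi> \<le> a"
      "x = c *\<^sub>R pt 1 0 + d *\<^sub>R spiral \<phi>"
  | (chord) c p q where "0 \<le> c" "0 \<le> p" "0 \<le> q"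
      "x = c *\<^sub>R pt 1 0 + p *\<^sub>R spiral 0 + q *\<^sub>R spiral a"
proof -
  have psi_nonneg: "0 \<le> psi u x" if "0 \<le> u" for u using assms that by (simp add: obs_cone_def)
  show ?thesis
  proof (cases "Y x = 0")
    case True
    then have "x = pt (Z x) 0" by (metis pt_coords)
    then have "0 \<le> Z x" using psi_nonneg[of 0] by (metis psi_axis order_refl)
    moreover have "x = Z x *\<^sub>R pt 1 0 + 0 *\<^sub>R spiral 0"
      using True by (intro coords_eqI) (simp_all add: ZY_simps)
    ultimately show ?thesis using arc[of "Z x" 0 0] a_bounds pi_gt_zero by linarith
  next
    case False
    show ?thesis
    proof (cases rule: polar_or_chord[OF False a_bounds, where r = r, case_names arc chord])
      case L: (arc s \<phi>)
      have x: "x = (Z x - s) *\<^sub>R pt 1 0 + s *\<^sub>R spiral \<phi>"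
        using L by (intro coords_eqI) (simp_all add: ZY_simps zeta_def)
      have "psi (a - \<phi>) ((Z x - s) *\<^sub>R pt 1 0 + s *\<^sub>R spiral \<phi>) = Z x - s"
        by (simp add: psi_simps psi_spiral)
      then have "0 \<le> Z x - s" using psi_nonneg[of "a - \<phi>"] L x by auto
      then show ?thesis using arc x L by (meson less_imp_le)
    next
      case L: (chord p q)
      have x: "x = (Z x - p - q) *\<^sub>R pt 1 0 + p *\<^sub>R spiral 0 + q *\<^sub>R spiral a"
        using L by (intro coords_eqI) (simp_all add: ZY_simps zeta_def)
      have "psi 0 ((Z x - p - q) *\<^sub>R pt 1 0 + p *\<^sub>R spiral 0 + q *\<^sub>R spiral a) = Z x - p - q"
        by (simp add: psi_simps psi_spiral gap_a)
      then have "0 \<le> Z x - p - q" using psi_nonneg[of 0] x by auto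
      then show ?thesis using chord x L by blast
    qed
  qed
qed

lemma obs_cone_Z_nonneg: "x \<in> obs_cone \<Longrightarrow> 0 \<le> Z x"
  by (erule obs_cone_cases) (simp_all add: ZY_simps)

lemma obs_cone_Z_zero: "x \<in> obs_cone \<Longrightarrow> Z x = 0 \<Longrightarrow> x = 0"
proof (erule obs_cone_cases)
  fix c d \<phi> assume "Z x = 0" "0 \<le> c" "0 \<le> d" and x: "x = c *\<^sub>R pt 1 0 + d *\<^sub>R spiral \<phi>"
  then have "c + d = 0" by (simp add: ZY_simps)
  with \<open>0 \<le> c\<close> \<open>0 \<le> d\<close> have "c = 0" "d = 0" by linarith+
  with x show "x = 0" by simp
next
  fix c p q assume "Z x = 0" "0 \<le> c" "0 \<le> p" "0 \<le> q"
    and x: "x = c *\<^sub>R pt 1 0 + p *\<^sub>R spiral 0 + q *\<^sub>R spiral a"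
  then have "c + p + q = 0" by (simp add: ZY_simps)
  with \<open>0 \<le> c\<close> \<open>0 \<le> p\<close> \<open>0 \<le> q\<close> have "c = 0" "p = 0" "q = 0" by linarith+
  with x show "x = 0" by simp
qed

lemma pointed_obs_cone: "obs_cone \<inter> uminus ` obs_cone = {0}"
proof -
  have "x = 0" if "x \<in> obs_cone" "- x \<in> obs_cone" for x
    using that obs_cone_Z_nonneg[of x] obs_cone_Z_nonneg[of "- x"] obs_cone_Z_zero[of x]
    by (simp add: linear_neg[OF linear_Z])
  moreover have "0 \<in> obs_cone" by (simp add: obs_cone_def psi_simps)
  ultimately show ?thesis by force
qed

text \<open>
  The coefficient of \<open>Y\<close> in \<open>psi u\<close> is bounded uniformly in \<open>u \<ge> 0\<close>, so the cone contains a circular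
  cone around the axis.
\<close>

lemma interior_obs_cone: "interior obs_cone \<noteq> {}"
proof -
  define k where "k = cmod zeta * exp (r * a)"
  define U where "U = {x. k * cmod (Y x) < Z x}"
  have "open U"
    unfolding U_def
    by (intro open_Collect_less continuous_intros linear_continuous_on
        linear_conv_bounded_linear[THEN iffD1] linear_Y linear_Z)
  moreover have "pt 1 0 \<in> U" by (simp add: U_def)
  moreover have "U \<subseteq> obs_cone"
  proof
    fix x assume x: "x \<in> U"
    have "0 \<le> psi u x" if "0 \<le> u" for u
    proof -
      have "\<bar>Im (cnj zeta * exp (zeta * of_real (u - a)) * Y x)\<bar> \<le>
          cmod (cnj zeta * exp (zeta * of_real (u - a)) * Y x)"
        by (rule abs_Im_le_cmod)
      also have "\<dots> = cmod zeta * exp (- r * (u - a)) * cmod (Y x)"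
        by (simp only: norm_mult norm_exp_zeta complex_mod_cnj)
      also have "\<dots> \<le> k * cmod (Y x)"
        unfolding k_def using that r_pos by (intro mult_right_mono mult_left_mono) (auto simp: algebra_simps)
      also have "\<dots> < Z x" using x by (simp add: U_def)
      finally show ?thesis by (simp add: psi_def)
    qed
    then show "x \<in> obs_cone" by (simp add: obs_cone_def)
  qed
  ultimately show ?thesis using interior_maximal by blast
qed

lemma proper_obs_cone: "proper_convex_cone obs_cone"
  by (simp add: proper_convex_cone_def convex_cone_obs_cone closed_obs_cone interior_obs_cone
      pointed_obs_cone)

lemma invariant_obs_cone: "invariant_for A (spiral 0) obs_cone"
proof -
  have "matrix_exp (t *\<^sub>R A) *v x \<in> obs_cone" if "0 \<le> t" "x \<in> obs_cone" for t x
    using that om_pos by (simp add: obs_cone_def psi_flow)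
  then show ?thesis using spiral_in_obs_cone[of 0] by (auto simp: invariant_for_def)
qed

lemma obs_cone_largest:
  assumes "invariant_for A (spiral 0) K" "K \<subseteq> {x. 0 \<le> psi 0 x}"
  shows "K \<subseteq> obs_cone"
proof
  fix x assume x: "x \<in> K"
  have "0 \<le> psi u x" if "0 \<le> u" for u
  proof -
    have "matrix_exp ((u / om) *\<^sub>R A) *v x \<in> K"
      using assms(1) x that om_pos by (intro invariant_forD) auto
    then have "0 \<le> psi 0 (matrix_exp ((u / om) *\<^sub>R A) *v x)" using assms(2) by auto
    then show ?thesis using om_pos by (simp add: psi_flow zero_le_mult_iff)
  qed
  then show "x \<in> obs_cone" by (simp add: obs_cone_def)
qed

text \<open>
  The trajectory spans, in the limit, the axis point and the whole arc, and these generate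
  \<open>obs_cone\<close>. In particular \<open>obs_cone\<close> is the smallest closed convex cone containing the trajectory.
\<close>

lemma cone_with_trajectory_contains:
  assumes "convex_cone K" "closed K"
    and traj: "\<And>t. 0 \<le> t \<Longrightarrow> matrix_exp (t *\<^sub>R A) *v spiral 0 \<in> K"
  shows "0 \<le> t \<Longrightarrow> spiral t \<in> K" "pt 1 0 \<in> K" "obs_cone \<subseteq> K"
proof -
  show sp: "spiral t \<in> K" if "0 \<le> t" for t
  proof -
    have "matrix_exp ((t / om) *\<^sub>R A) *v spiral 0 \<in> K"
      using that om_pos by (intro traj) auto
    then have "exp (lam * (t / om)) *\<^sub>R spiral t \<in> K" using om_pos by (simp add: flow_spiral)
    then have "exp (- (lam * (t / om))) *\<^sub>R exp (lam * (t / om)) *\<^sub>R spiral t \<in> K"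
      by (rule convex_cone_scaleR[OF assms(1) exp_ge_zero])
    then show ?thesis by (simp add: exp_minus)
  qed
  show ax: "pt 1 0 \<in> K"
    by (rule Lim_in_closed_set[OF assms(2) _ _ spiral_tendsto_axis])
      (auto intro: eventually_mono[OF eventually_ge_at_top[of 0]] sp)
  show "obs_cone \<subseteq> K"
  proof
    fix x assume "x \<in> obs_cone"
    then show "x \<in> K"
      by (cases rule: obs_cone_cases)
        (use a_bounds pi_gt_zero in \<open>auto intro!: convex_cone_add convex_cone_scaleR assms(1) sp ax\<close>)
  qed
qed

lemma invariant_trajectory:
  "invariant_for A B K \<Longrightarrow> 0 \<le> t \<Longrightarrow> matrix_exp (t *\<^sub>R A) *v B \<in> K"
  by (rule invariant_forD[of A B]) (simp_all add: invariant_for_def)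

lemma reachable_cone_eq: "reachable_cone A (spiral 0) = obs_cone"
proof
  let ?S = "{matrix_exp (t *\<^sub>R A) *v spiral 0 | t. t \<ge> 0}"
  have "?S \<subseteq> obs_cone"
    using invariant_trajectory[OF invariant_obs_cone] by blast
  then have "convex_cone hull ?S \<subseteq> obs_cone"
    by (intro hull_minimal convex_cone_obs_cone)
  then show "reachable_cone A (spiral 0) \<subseteq> obs_cone"
    unfolding reachable_cone_def by (intro closure_minimal closed_obs_cone)
  show "obs_cone \<subseteq> reachable_cone A (spiral 0)"
  proof (rule cone_with_trajectory_contains(3))
    show "convex_cone (reachable_cone A (spiral 0))"
      using convex_cone_convex_cone_hull
      by (auto simp: convex_cone_def reachable_cone_def intro: convex_closure conic_closure)
    show "closed (reachable_cone A (spiral 0))" by (simp add: reachable_cone_def)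
    show "matrix_exp (t *\<^sub>R A) *v spiral 0 \<in> reachable_cone A (spiral 0)" if "0 \<le> t" for t
    proof -
      have "matrix_exp (t *\<^sub>R A) *v spiral 0 \<in> convex_cone hull ?S"
        using that by (intro hull_inc) auto
      then show ?thesis unfolding reachable_cone_def using closure_subset by blast
    qed
  qed
qed

lemma obs_cone_not_polyhedral: "\<not> polyhedral_cone obs_cone"
proof
  assume "polyhedral_cone obs_cone"
  then obtain m :: nat and N :: "nat \<Rightarrow> real^3" where
    N: "obs_cone = {\<Sum>i<m. y i *\<^sub>R N i | y :: nat \<Rightarrow> real. \<forall>i<m. y i \<ge> 0}"
    unfolding polyhedral_cone_def by blast
  have N_mem: "N i \<in> obs_cone" if "i < m" for i
  proof -
    have "(\<Sum>j<m. (if j = i then 1 else 0) *\<^sub>R N j) = (\<Sum>j<m. if j = i then N j else 0)"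
      by (rule sum.cong) auto
    also have "\<dots> = N i" using that by simp
    finally have "N i = (\<Sum>j<m. (if j = i then 1 else 0) *\<^sub>R N j)" by simp
    then show ?thesis
      unfolding N mem_Collect_eq by (intro exI[of _ "\<lambda>j. if j = i then 1 else 0"]) auto
  qed
  have "\<exists>i<m. \<exists>d. d \<noteq> 0 \<and> N i = d *\<^sub>R spiral t" if t: "0 < t" "t < a" for t
  proof -
    have mem: "spiral t \<in> obs_cone" using t by (intro spiral_in_obs_cone) auto
    then obtain y where y: "spiral t = (\<Sum>i<m. y i *\<^sub>R N i)" "\<forall>i<m. 0 \<le> y i"
      unfolding N by blast
    have nz: "spiral t \<noteq> 0" by (metis Z_spiral linear_0[OF linear_Z] zero_neq_one)
    have psi0: "psi (a - t) (spiral t) = 0" by (simp add: psi_spiral)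
    have nn: "0 \<le> psi (a - t) (N i)" if "i < m" for i
      using N_mem[OF that] t by (simp add: obs_cone_def)
    obtain i where i: "i < m" "N i \<noteq> 0" "psi (a - t) (N i) = 0"
      by (rule finitely_generated_halfspace_zero[OF y nz linear_psi psi0 nn])
    \<comment> \<open>The tangent at time \<open>t\<close> touches the arc in one point only.\<close>
    have pos: "0 < gap r (s - t)" if "0 \<le> s" "s \<le> a" "s \<noteq> t" for s
      using gap_pos_left[OF gap_a a_bounds, of "s - t"] gap_pos_right[OF r_pos, of "s - t"] that t
      by (cases "s < t") auto
    from N_mem[OF i(1)] have "\<exists>d. N i = d *\<^sub>R spiral t"
    proof (cases rule: obs_cone_cases)
      case (arc c d \<phi>)
      have "c + d * gap r (\<phi> - t) = 0" using i(3) arc by (simp add: psi_simps psi_spiral)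
      moreover have "0 \<le> d * gap r (\<phi> - t)"
        using arc pos[of \<phi>] by (cases "\<phi> = t") auto
      ultimately have "c = 0" "d * gap r (\<phi> - t) = 0" using arc by linarith+
      then show ?thesis using arc pos[of \<phi>] by (cases "\<phi> = t") auto
    next
      case (chord c p q)
      have g: "0 < gap r (0 - t)" "0 < gap r (a - t)" using t pos[of 0] pos[of a] by simp_all
      have "c + p * gap r (0 - t) + q * gap r (a - t) = 0"
        using i(3) chord by (simp add: psi_simps psi_spiral)
      moreover have "0 \<le> p * gap r (0 - t)" "0 \<le> q * gap r (a - t)" using chord g by auto
      ultimately have "c = 0" "p * gap r (0 - t) = 0" "q * gap r (a - t) = 0" using chord by linarith+
      with chord g i(2) show ?thesis by auto
    qed
    with i show ?thesis by auto
  qed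
  then have "\<forall>t\<in>{0<..<a}. \<exists>i. i < m \<and> (\<exists>d. d \<noteq> 0 \<and> N i = d *\<^sub>R spiral t)" by simp
  then obtain f where f: "\<And>t. t \<in> {0<..<a} \<Longrightarrow> f t < m \<and> (\<exists>d. d \<noteq> 0 \<and> N (f t) = d *\<^sub>R spiral t)"
    by metis
  have "inj_on f {0<..<a}"
  proof (rule inj_onI)
    fix s t assume st: "s \<in> {0<..<a}" "t \<in> {0<..<a}" "f s = f t"
    obtain d where d: "d \<noteq> 0" "N (f s) = d *\<^sub>R spiral s" using f[OF st(1)] by blast
    obtain d' where d': "d' \<noteq> 0" "N (f s) = d' *\<^sub>R spiral t" using f[OF st(2)] st(3) by auto
    have eq: "d *\<^sub>R spiral s = d' *\<^sub>R spiral t" using d d' by simp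
    from arg_cong[OF eq, of Z] have "d = d'" by (simp add: ZY_simps)
    with eq d have "spiral s = spiral t" by simp
    from arg_cong[OF this, of "\<lambda>x. cmod (Y x)"] show "s = t" using r_pos
      by (simp add: norm_exp_zeta zeta_def)
  qed
  moreover have "f ` {0<..<a} \<subseteq> {..<m}" using f by auto
  ultimately have "finite {0<..<a}"
    using inj_on_finite[of f "{0<..<a}" "{..<m}"] by simp
  then show False using a_bounds pi_gt_zero infinite_Ioo[of 0 a] by linarith
qed

text \<open>
  The size of the perturbation of the functional; any positive number small enough for
  \<open>second_order_cone_avoids_wedge\<close> with \<open>\<mu> = gap r a\<close>, the value of \<open>psi a\<close> at \<open>spiral a\<close>, would do. The
  summand 13 in place of 12 makes the required inequality strict.
\<close>

definition margin :: real where
  "margin = 1 / (112 * (1 + gap r a) / (gap r a)\<^sup>2 + 13)"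

lemma gap_a_pos: "0 < gap r a"
  using gap_pos_right[OF r_pos, of a] a_bounds pi_gt_zero by linarith

lemma margin_pos: "0 < margin"
  and margin_small: "margin * (112 * (1 + gap r a) / (gap r a)\<^sup>2 + 12) < 1"
proof -
  have "0 < 112 * (1 + gap r a) / (gap r a)\<^sup>2" using gap_a_pos by simp
  then show "0 < margin" "margin * (112 * (1 + gap r a) / (gap r a)\<^sup>2 + 12) < 1"
    by (auto simp: margin_def)
qed

text \<open>
  The wedge is given by \<open>X = psi a\<close> and \<open>V = psi 0\<close>, which both vanish at \<open>spiral 0\<close>.
\<close>

lemma no_second_order_cone:
  assumes "second_order_cone K" "convex_cone K" "closed K" "invariant_for A (spiral 0) K"
    and \<eta>: "0 \<le> \<eta>" "\<eta> \<le> margin"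
    and sub: "K \<subseteq> {x. 0 \<le> psi 0 x + \<eta> * Z x}"
  shows False
proof -
  have shifted: "0 \<le> psi u x + \<eta> * Z x" if x: "x \<in> K" and u: "0 \<le> u" for x u
  proof -
    let ?y = "matrix_exp ((u / om) *\<^sub>R A) *v x"
    have "?y \<in> K" using assms(4) x u om_pos by (intro invariant_forD) auto
    then have "0 \<le> psi 0 ?y + \<eta> * Z ?y" using sub by auto
    also have "\<dots> = exp (lam * (u / om)) * (psi u x + \<eta> * Z x)"
      using om_pos by (simp add: psi_flow Z_flow algebra_simps)
    finally show ?thesis by (simp add: zero_le_mult_iff)
  qed
  \<comment> \<open>Letting \<open>u\<close> tend to infinity gives nonnegativity of \<open>Z\<close>.\<close>
  have Z_nonneg: "0 \<le> Z x" if x: "x \<in> K" for x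
  proof -
    have "((\<lambda>u. psi u x + \<eta> * Z x) \<longlongrightarrow> Z x + \<eta> * Z x) at_top"
      by (intro tendsto_intros psi_tendsto_Z)
    then have "0 \<le> Z x + \<eta> * Z x"
      by (rule tendsto_lowerbound)
        (auto intro: eventually_mono[OF eventually_ge_at_top[of 0]] shifted x)
    then have "0 \<le> (1 + \<eta>) * Z x" by (simp add: algebra_simps)
    then show ?thesis using \<eta> by (simp add: zero_le_mult_iff)
  qed
  have small: "\<eta> * (112 * (1 + gap r a) / (gap r a)\<^sup>2 + 12) < 1"
  proof -
    have "\<eta> * (112 * (1 + gap r a) / (gap r a)\<^sup>2 + 12) \<le> margin * (112 * (1 + gap r a) / (gap r a)\<^sup>2 + 12)"
      using \<eta> gap_a_pos by (intro mult_right_mono) auto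
    with margin_small show ?thesis by linarith
  qed
  have a0: "0 \<le> a" using a_bounds pi_gt_zero by linarith
  note mem = cone_with_trajectory_contains[OF assms(2,3) invariant_trajectory[OF assms(4)]]
  show False
    by (rule second_order_cone_avoids_wedge[of "psi a" "psi 0" Z K "spiral 0" "spiral a" "pt 1 0" "gap r a" \<eta>])
      (use assms a0 mem small gap_a_pos shifted Z_nonneg in
        \<open>auto simp: linear_psi linear_Z psi_spiral gap_a\<close>)
qed

lemma spiral_flow_conclusion:
  "\<exists>B C \<Delta>C :: real^3.
     ((\<forall>t\<ge>0. C \<bullet> (matrix_exp (t *\<^sub>R A) *v B) \<ge> 0) \<and>
      (\<forall>K. proper_convex_cone K \<and> invariant_for A B K \<and> K \<subseteq> {x. C \<bullet> x \<ge> 0}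
            \<longleftrightarrow> K = reachable_cone A B) \<and>
      \<not> polyhedral_cone (reachable_cone A B) \<and>
      \<not> second_order_cone (reachable_cone A B)) \<and>
     ((\<forall>t\<ge>0. (C + \<Delta>C) \<bullet> (matrix_exp (t *\<^sub>R A) *v B) > 0) \<and>
      \<not> (\<exists>K. proper_convex_cone K \<and> invariant_for A B K \<and>
             K \<subseteq> {x. (C + \<Delta>C) \<bullet> x \<ge> 0} \<and> second_order_cone K))"
proof -
  obtain C where C: "\<And>x. C \<bullet> x = psi 0 x" using linear_functional_inner[OF linear_psi] by blast
  obtain W where W: "\<And>x. W \<bullet> x = Z x" using linear_functional_inner[OF linear_Z] by blast
  have CW: "(C + margin *\<^sub>R W) \<bullet> x = psi 0 x + margin * Z x" for x
    by (simp add: inner_add_left C W)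
  have traj: "0 \<le> psi 0 (matrix_exp (t *\<^sub>R A) *v spiral 0)" if "0 \<le> t" for t
    using spiral_in_obs_cone[of 0] om_pos that by (simp add: psi_flow obs_cone_def)
  have sub: "obs_cone \<subseteq> {x. 0 \<le> psi 0 x}" by (auto simp: obs_cone_def)
  show ?thesis
  proof (rule exI[of _ "spiral 0"], rule exI[of _ C], rule exI[of _ "margin *\<^sub>R W"],
      unfold reachable_cone_eq CW C, intro conjI allI impI, goal_cases)
    case (1 t) then show ?case by (rule traj)
  next
    case (2 K)
    have "K = obs_cone" if "proper_convex_cone K" "invariant_for A (spiral 0) K"
      "K \<subseteq> {x. 0 \<le> psi 0 x}"
      using obs_cone_largest[of K] cone_with_trajectory_contains(3)[of K] invariant_trajectory that
      by (auto simp: proper_convex_cone_def)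
    then show ?case using proper_obs_cone invariant_obs_cone sub by blast
  next
    case 3 show ?case by (rule obs_cone_not_polyhedral)
  next
    case 4
    show ?case
      using no_second_order_cone[of obs_cone 0] convex_cone_obs_cone closed_obs_cone
        invariant_obs_cone sub margin_pos by auto
  next
    case (5 t)
    have "0 < margin * Z (matrix_exp (t *\<^sub>R A) *v spiral 0)"
      using margin_pos by (simp add: Z_flow)
    then show ?case using traj[OF 5] by linarith
  next
    case 6
    show ?case
      using no_second_order_cone[of _ margin] margin_pos by (auto simp: proper_convex_cone_def)
  qed
qed

end

section \<open>Spectral coordinates\<close>

text \<open>
  Eigenvectors of the transpose are linear functionals on which the matrix acts as a scalar.
\<close>

lemma complex_left_eigenvector:
  fixes A :: "real^'n^'n"
  assumes "det (mat z - map_matrix complex_of_real A) = 0"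
  obtains v :: "complex^'n" where "v \<noteq> 0"
    "\<And>j. (\<Sum>i\<in>UNIV. v $ i * of_real (A $ i $ j)) = z * v $ j"
proof -
  let ?M = "transpose (mat z - map_matrix complex_of_real A)"
  have "\<not> invertible ?M" using assms by (simp add: invertible_det_nz)
  then obtain v where v: "v \<noteq> 0" "?M *v v = 0"
    using invertible_left_inverse matrix_left_invertible_ker by metis
  show thesis
  proof (rule that[OF v(1)])
    fix j
    have "0 = (?M *v v) $ j" using v by simp
    also have "\<dots> = (\<Sum>i\<in>UNIV. (if i = j then z * v $ i else 0) - v $ i * of_real (A $ i $ j))"
      unfolding matrix_vector_mult_def transpose_def mat_def
      by (auto intro!: sum.cong simp: algebra_simps)
    also have "\<dots> = z * v $ j - (\<Sum>i\<in>UNIV. v $ i * of_real (A $ i $ j))"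
      by (simp add: sum_subtractf)
    finally show "(\<Sum>i\<in>UNIV. v $ i * of_real (A $ i $ j)) = z * v $ j" by simp
  qed
qed

lemma complex_eigenfunctional:
  fixes A :: "real^'n^'n"
  assumes "det (mat z - map_matrix complex_of_real A) = 0"
  obtains Y :: "real^'n \<Rightarrow> complex" where "linear Y" "\<And>x. Y (A *v x) = z * Y x" "\<exists>x. Y x \<noteq> 0"
proof -
  obtain v where v: "v \<noteq> 0" "\<And>j. (\<Sum>i\<in>UNIV. v $ i * of_real (A $ i $ j)) = z * v $ j"
    using complex_left_eigenvector[OF assms] by blast
  define Y where "Y = (\<lambda>x::real^'n. \<Sum>i\<in>UNIV. v $ i * of_real (x $ i))"
  show thesis
  proof (rule that)
    show "linear Y"
      by (rule linearI)
        (simp_all add: Y_def sum.distrib distrib_left scaleR_sum_right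
          scaleR_conv_of_real[where 'a = complex] sum_distrib_left mult.left_commute)
    show "Y (A *v x) = z * Y x" for x
    proof -
      have "Y (A *v x) = (\<Sum>i\<in>UNIV. \<Sum>j\<in>UNIV. v $ i * of_real (A $ i $ j) * of_real (x $ j))"
        by (simp add: Y_def matrix_vector_mult_def sum_distrib_left mult.assoc)
      also have "\<dots> = (\<Sum>j\<in>UNIV. \<Sum>i\<in>UNIV. v $ i * of_real (A $ i $ j) * of_real (x $ j))"
        by (rule sum.swap)
      also have "\<dots> = (\<Sum>j\<in>UNIV. z * v $ j * of_real (x $ j))"
        by (simp add: v(2) flip: sum_distrib_right)
      finally show ?thesis by (simp add: Y_def sum_distrib_left mult.assoc)
    qed
    obtain i where "v $ i \<noteq> 0" using v(1) by (auto simp: vec_eq_iff)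
    moreover have "Y (axis i 1) = (\<Sum>k\<in>UNIV. if k = i then v $ k else 0)"
      unfolding Y_def by (rule sum.cong) (auto simp: axis_def)
    then have "Y (axis i 1) = v $ i" by simp
    ultimately show "\<exists>x. Y x \<noteq> 0" by metis
  qed
qed

lemma real_eigenfunctional:
  fixes A :: "real^'n^'n"
  assumes "det (mat (of_real lam) - map_matrix complex_of_real A) = 0"
  obtains Z :: "real^'n \<Rightarrow> real" where "linear Z" "\<And>x. Z (A *v x) = lam * Z x" "\<exists>x. Z x \<noteq> 0"
proof -
  obtain Y :: "real^'n \<Rightarrow> complex"
    where Y: "linear Y" "\<And>x. Y (A *v x) = of_real lam * Y x" "\<exists>x. Y x \<noteq> 0"
    using complex_eigenfunctional[OF assms] by blast
  have lin: "linear (\<lambda>x. Re (Y x))" "linear (\<lambda>x. Im (Y x))"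
    by (simp_all add: linear_iff linear_add[OF Y(1)] linear_scale[OF Y(1)])
  have eig: "Re (Y (A *v x)) = lam * Re (Y x)" "Im (Y (A *v x)) = lam * Im (Y x)" for x
    by (simp_all add: Y(2))
  obtain x where "Y x \<noteq> 0" using Y(3) by blast
  then consider "Re (Y x) \<noteq> 0" | "Im (Y x) \<noteq> 0" by (metis complex_eqI zero_complex.sel)
  then show thesis
  proof cases
    case 1 then show thesis using that[OF lin(1)] eig(1) by blast
  next
    case 2 then show thesis using that[OF lin(2)] eig(2) by blast
  qed
qed

text \<open>
  The range of \<open>(Z, Y)\<close> is invariant under the pair \<open>(lam, l)\<close>. Subtracting \<open>lam\<close> kills the first
  coordinate, and a nonzero complex number together with its multiple by the nonreal \<open>l\<close> spans the
  complex plane over the reals.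
\<close>

lemma eigenfunctionals_surj:
  fixes Z :: "'a::real_vector \<Rightarrow> real" and Y :: "'a \<Rightarrow> complex"
  assumes Z: "linear Z" "\<And>x. Z (f x) = lam * Z x" "\<exists>x. Z x \<noteq> 0"
    and Y: "linear Y" "\<And>x. Y (f x) = l * Y x" "\<exists>x. Y x \<noteq> 0"
    and l: "Im l \<noteq> 0"
  shows "\<exists>x. Z x = z \<and> Y x = y"
proof -
  note lin = linear_add[OF Z(1)] linear_add[OF Y(1)] linear_diff[OF Z(1)] linear_diff[OF Y(1)]
    linear_scale[OF Z(1)] linear_scale[OF Y(1)]
  obtain x1 x2 where x1: "Z x1 \<noteq> 0" and x2: "Y x2 \<noteq> 0" using Z(3) Y(3) by blast
  define w where "w = f x2 - lam *\<^sub>R x2"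
  define e where "e = (l - of_real lam) * Y x2"
  have w: "Z w = 0" "Y w = e" by (simp_all add: w_def e_def lin Z(2) Y(2) algebra_simps scaleR_conv_of_real)
  have "l \<noteq> of_real lam" using l by auto
  then have e0: "e \<noteq> 0" using x2 by (simp add: e_def)
  have plane: "\<exists>x. Z x = 0 \<and> Y x = y" for y
  proof -
    define t where "t = Im (y / e) / Im l"
    define s where "s = Re (y / e) - t * Re l"
    have "y / e = of_real s + of_real t * l" using l by (simp add: s_def t_def complex_eq_iff)
    then have "y = of_real s * e + of_real t * (l * e)"
      using e0 by (simp add: field_simps)
    then have "Z (s *\<^sub>R w + t *\<^sub>R f w) = 0 \<and> Y (s *\<^sub>R w + t *\<^sub>R f w) = y"
      by (simp add: lin w Z(2) Y(2) scaleR_conv_of_real)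
    then show ?thesis by blast
  qed
  obtain x where "Z x = 0" "Y x = y - (z / Z x1) *\<^sub>R Y x1" using plane by blast
  then have "Z ((z / Z x1) *\<^sub>R x1 + x) = z \<and> Y ((z / Z x1) *\<^sub>R x1 + x) = y"
    using x1 by (simp add: lin)
  then show ?thesis by blast
qed

text \<open>
  In the coordinates the \<open>k\<close>-th power of the matrix is \<open>(p ^ k, q ^ k)\<close>. So each term of the
  exponential series is a fixed linear combination of three matrices \<open>R\<close>, \<open>S\<close>, \<open>T\<close>, and its
  convergence follows from that of the scalar exponential series.
\<close>

lemma matrix_exp_coordinates:
  fixes M :: "real^'n^'n" and Z :: "real^'n \<Rightarrow> real" and Y :: "real^'n \<Rightarrow> complex"
  assumes Z: "linear Z" "\<And>x. Z (M *v x) = p * Z x"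
    and Y: "linear Y" "\<And>x. Y (M *v x) = q * Y x"
    and pt: "\<And>z y. Z (pt z y) = z" "\<And>z y. Y (pt z y) = y" "\<And>x. pt (Z x) (Y x) = x"
  shows "Z (matrix_exp M *v x) = exp p * Z x" "Y (matrix_exp M *v x) = exp q * Y x"
proof -
  note lin = linear_add[OF Z(1)] linear_add[OF Y(1)] linear_scale[OF Z(1)] linear_scale[OF Y(1)]
  have eqI: "x = x'" if "Z x = Z x'" "Y x = Y x'" for x x' by (metis pt(3) that)
  define R S T where "R = matrix (\<lambda>x. pt (Z x) 0)" and "S = matrix (\<lambda>x. pt 0 (Y x))"
    and "T = matrix (\<lambda>x. pt 0 (\<i> * Y x))"
  have R: "R *v x = pt (Z x) 0" for x
    unfolding R_def by (rule fun_cong[OF matrix_vector_mul(2)]) (auto intro!: linearI eqI simp: lin pt)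
  have S: "S *v x = pt 0 (Y x)" for x
    unfolding S_def by (rule fun_cong[OF matrix_vector_mul(2)]) (auto intro!: linearI eqI simp: lin pt)
  have T: "T *v x = pt 0 (\<i> * Y x)" for x
    unfolding T_def by (rule fun_cong[OF matrix_vector_mul(2)]) (auto intro!: linearI eqI simp: lin pt algebra_simps)
  have comb: "Z ((c *\<^sub>R R + Re d *\<^sub>R S + Im d *\<^sub>R T) *v x) = c * Z x"
    "Y ((c *\<^sub>R R + Re d *\<^sub>R S + Im d *\<^sub>R T) *v x) = d * Y x" for c d x
    by (simp_all add: matrix_vector_mult_add_rdistrib scaleR_matrix_vector_assoc[symmetric]
        R S T lin pt complex_eq_iff)
  have power: "Z (((**) M ^^ k) (mat 1) *v x) = p ^ k * Z x"
    "Y (((**) M ^^ k) (mat 1) *v x) = q ^ k * Y x" for k x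
    by (induction k) (simp_all add: matrix_vector_mul_assoc[symmetric] Z Y)
  have "(1 / fact k) *\<^sub>R (((**) M ^^ k) (mat 1)) =
      (p ^ k /\<^sub>R fact k) *\<^sub>R R + Re (q ^ k /\<^sub>R fact k) *\<^sub>R S + Im (q ^ k /\<^sub>R fact k) *\<^sub>R T" for k
    unfolding matrix_eq
    by (intro allI eqI; simp only: comb)
      (simp_all add: scaleR_matrix_vector_assoc[symmetric] lin power divide_inverse)
  moreover have "(\<lambda>k. (p ^ k /\<^sub>R fact k) *\<^sub>R R + Re (q ^ k /\<^sub>R fact k) *\<^sub>R S + Im (q ^ k /\<^sub>R fact k) *\<^sub>R T)
      sums (exp p *\<^sub>R R + Re (exp q) *\<^sub>R S + Im (exp q) *\<^sub>R T)"
    by (intro sums_add bounded_linear.sums[OF bounded_linear_scaleR_left]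
        bounded_linear.sums[OF bounded_linear_Re] bounded_linear.sums[OF bounded_linear_Im]
        exp_converges)
  ultimately have "matrix_exp M = exp p *\<^sub>R R + Re (exp q) *\<^sub>R S + Im (exp q) *\<^sub>R T"
    unfolding matrix_exp_def by (simp add: sums_unique[symmetric])
  then show "Z (matrix_exp M *v x) = exp p * Z x" "Y (matrix_exp M *v x) = exp q * Y x"
    by (simp_all add: comb)
qed

text \<open>The characteristic polynomial is real, so the conjugate of \<open>l2\<close> is also an eigenvalue.\<close>

lemma ordered_eigenvalues_conjugate:
  assumes ev: "ordered_eigenvalues A l1 l2 l3" and l1: "l1 \<in> \<real>" and l2: "Im l2 \<noteq> 0"
  shows "l3 = cnj l2"
proof -
  have char_poly: "det (mat z - map_matrix complex_of_real A) = (z - l1) * (z - l2) * (z - l3)" for z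
    using ev by (simp add: ordered_eigenvalues_def)
  have "det (mat (cnj l2) - map_matrix complex_of_real A) =
      cnj (det (mat l2 - map_matrix complex_of_real A))"
    by (simp add: det_3 mat_def)
  then have "(cnj l2 - l1) * (cnj l2 - l2) * (cnj l2 - l3) = 0"
    unfolding char_poly by simp
  moreover have "cnj l2 \<noteq> l1" "cnj l2 \<noteq> l2"
    using l1 l2 by (auto simp: complex_eq_iff complex_is_Real_iff)
  ultimately show ?thesis by simp
qed

theorem proposition3:
  fixes A :: "real^3^3" and l1 l2 l3 :: complex
  assumes "ordered_eigenvalues A l1 l2 l3"
    and "l1 \<in> \<real>"
    and "l1 \<noteq> complex_of_real (Re l2)"
    and "Im l2 \<noteq> 0"
  shows "\<exists>B C \<Delta>C :: real^3.
     ((\<forall>t\<ge>0. C \<bullet> (matrix_exp (t *\<^sub>R A) *v B) \<ge> 0) \<and>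
      (\<forall>K. proper_convex_cone K \<and> invariant_for A B K \<and> K \<subseteq> {x. C \<bullet> x \<ge> 0}
            \<longleftrightarrow> K = reachable_cone A B) \<and>
      \<not> polyhedral_cone (reachable_cone A B) \<and>
      \<not> second_order_cone (reachable_cone A B)) \<and>
     ((\<forall>t\<ge>0. (C + \<Delta>C) \<bullet> (matrix_exp (t *\<^sub>R A) *v B) > 0) \<and>
      \<not> (\<exists>K. proper_convex_cone K \<and> invariant_for A B K \<and>
             K \<subseteq> {x. (C + \<Delta>C) \<bullet> x \<ge> 0} \<and> second_order_cone K))"
proof -
  have char_poly: "det (mat z - map_matrix complex_of_real A) = (z - l1) * (z - l2) * (z - l3)" for z
    using assms(1) by (simp add: ordered_eigenvalues_def)
  have l3: "l3 = cnj l2" using ordered_eigenvalues_conjugate assms by blast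
  obtain lam where lam: "l1 = of_real lam" using assms(2) by (auto elim: Reals_cases)
  \<comment> \<open>\<open>l3\<close> has positive imaginary part, because equal real parts are ordered by imaginary part.\<close>
  define om where "om = Im l3"
  define r where "r = (lam - Re l3) / om"
  have om: "0 < om" using assms l3 by (auto simp: om_def ordered_eigenvalues_def eig_precedes_def)
  have "Re l3 < lam" using assms l3 lam by (auto simp: ordered_eigenvalues_def eig_precedes_def)
  then have r: "0 < r" using om by (simp add: r_def)
  obtain Z where Z: "linear Z" "\<And>x. Z (A *v x) = lam * Z x" "\<exists>x. Z x \<noteq> 0"
    using real_eigenfunctional[of lam A] char_poly lam by auto
  obtain Y where Y: "linear Y" "\<And>x. Y (A *v x) = l3 * Y x" "\<exists>x. Y x \<noteq> 0"
    using complex_eigenfunctional[of l3 A] char_poly by auto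
  define T where "T = (\<lambda>x. (Z x, Y x))"
  have "linear T" unfolding T_def
    by (intro linearI) (simp_all add: linear_add[OF Z(1)] linear_add[OF Y(1)]
        linear_scale[OF Z(1)] linear_scale[OF Y(1)])
  moreover have surj: "surj T"
    unfolding surj_def T_def
  proof (intro allI, safe)
    fix z y
    have "Im l3 \<noteq> 0" using om by (simp add: om_def)
    from eigenfunctionals_surj[OF Z Y this] show "\<exists>x. (z, y) = (Z x, Y x)" by metis
  qed
  ultimately have inj: "inj T"
    by (rule linear_surjective_imp_injective) simp
  define pt where "pt = (\<lambda>z y. inv T (z, y))"
  have "T (pt z y) = (z, y)" for z y unfolding pt_def by (rule surj_f_inv_f[OF surj])
  then have pt: "Z (pt z y) = z" "Y (pt z y) = y" for z y by (simp_all add: T_def)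
  have pt': "pt (Z x) (Y x) = x" for x using inv_f_f[OF inj, of x] by (simp add: pt_def T_def)
  obtain a where a: "pi < a" "a < 2 * pi" "gap r (- a) = 0" using gap_left_root[OF r] .
  have scaled: "Z ((t *\<^sub>R A) *v x) = (lam * t) * Z x" "Y ((t *\<^sub>R A) *v x) = (of_real t * l3) * Y x" for t x
    by (simp_all add: scaleR_matrix_vector_assoc[symmetric] linear_scale[OF Z(1)] linear_scale[OF Y(1)]
        Z(2) Y(2) scaleR_conv_of_real[where 'a = complex])
  have flow: "Z (matrix_exp (t *\<^sub>R A) *v x) = exp (lam * t) * Z x"
    "Y (matrix_exp (t *\<^sub>R A) *v x) = exp (of_real t * l3) * Y x" for t x
    using matrix_exp_coordinates[OF Z(1) scaled(1) Y(1) scaled(2) pt pt'] by blast+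
  have exp_l3: "exp (of_real t * l3) = exp (lam * t) *\<^sub>R exp (Complex (- r) 1 * of_real (om * t))" for t
  proof -
    have "of_real t * l3 = of_real (lam * t) + Complex (- r) 1 * of_real (om * t)"
      using om by (simp add: complex_eq_iff r_def om_def field_simps)
    then show ?thesis by (simp only: exp_add exp_of_real scaleR_conv_of_real)
  qed
  have "spiral_flow A Z Y pt lam om r a"
  proof (rule spiral_flow.intro)
    show "Z (matrix_exp (t *\<^sub>R A) *v x) = exp (lam * t) * Z x" for t x
      by (rule flow(1))
    show "Y (matrix_exp (t *\<^sub>R A) *v x) =
        exp (lam * t) *\<^sub>R (exp (Complex (- r) 1 * of_real (om * t)) * Y x)" for t x
      unfolding flow(2) exp_l3 by (rule mult_scaleR_left)
  qed (rule Z(1) Y(1) pt pt' om r a)+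
  then show ?thesis by (rule spiral_flow.spiral_flow_conclusion)
qed

end
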